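(* Let $G\equiv\mathbb{Z}$ (as ordered groups in $\mathcal{L}_{Pres}$) and let $\mathcal{L}\supseteq\mathcal{L}_{Pres}$. Assume that $Th(G,\mathcal{L})$ satisfies EP and DC. Then for every definable $X\subseteq G$, the set $X\cap\mathbb{N}$ is a finite union of points and of cosets of $d\mathbb{N}$ for some $d\in\mathbb{N}$.
   Context: $\mathcal{L}_{Pres}=(+,-,0,1,<,\equiv_n (n\in\mathbb{N}))$. $\mathbb{N}$ denotes the standard natural numbers $0,1,1+1,\dots$ inside $G$. "Definable" means $\mathcal{L}$-definable with parameters. For $A\subseteq M$, $dcl(A)$ is the set of elements $a$ that are the unique solution of some $\mathcal{L}$-formula $\Phi(x,\bar b)$ with $\bar b\subseteq A$. A theory satisfies EP if in every model, for all $A$ and $a,b$: $a\in dcl(A\cup\{b\})\setminus dcl(A)$ implies $b\in dcl(A\cup\{a\})$. DC means every definable subset of $G$ has a supremum in $G\cup\{\infty\}$. *)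

theory Defs
  imports Main
begin

section \<open>First-order logic with equality\<close>

datatype 'f tm = Var nat | Fun 'f "'f tm list"

datatype ('f, 'r) fm =
    Eq "'f tm" "'f tm"
  | Rel 'r "'f tm list"
  | Neg "('f, 'r) fm"
  | Conj "('f, 'r) fm" "('f, 'r) fm"
  | Exi nat "('f, 'r) fm"

record ('f, 'r) lang =
  funs :: "'f set"
  rels :: "'r set"
  farity :: "'f \<Rightarrow> nat"
  rarity :: "'r \<Rightarrow> nat"

definition sublang :: "('f, 'r) lang \<Rightarrow> ('f, 'r) lang \<Rightarrow> bool" where
  "sublang L L' \<longleftrightarrow>
     funs L \<subseteq> funs L' \<and> rels L \<subseteq> rels L' \<and>
     (\<forall>f\<in>funs L. farity L f = farity L' f) \<and>
     (\<forall>r\<in>rels L. rarity L r = rarity L' r)"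

fun wf_tm :: "('f, 'r) lang \<Rightarrow> 'f tm \<Rightarrow> bool" where
  "wf_tm L (Var n) \<longleftrightarrow> True"
| "wf_tm L (Fun f ts) \<longleftrightarrow> f \<in> funs L \<and> length ts = farity L f \<and> (\<forall>t\<in>set ts. wf_tm L t)"

fun wf_fm :: "('f, 'r) lang \<Rightarrow> ('f, 'r) fm \<Rightarrow> bool" where
  "wf_fm L (Eq s t) \<longleftrightarrow> wf_tm L s \<and> wf_tm L t"
| "wf_fm L (Rel r ts) \<longleftrightarrow> r \<in> rels L \<and> length ts = rarity L r \<and> (\<forall>t\<in>set ts. wf_tm L t)"
| "wf_fm L (Neg p) \<longleftrightarrow> wf_fm L p"
| "wf_fm L (Conj p q) \<longleftrightarrow> wf_fm L p \<and> wf_fm L q"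
| "wf_fm L (Exi x p) \<longleftrightarrow> wf_fm L p"

fun fv_tm :: "'f tm \<Rightarrow> nat set" where
  "fv_tm (Var n) = {n}"
| "fv_tm (Fun f ts) = (\<Union>t\<in>set ts. fv_tm t)"

fun fv :: "('f, 'r) fm \<Rightarrow> nat set" where
  "fv (Eq s t) = fv_tm s \<union> fv_tm t"
| "fv (Rel r ts) = (\<Union>t\<in>set ts. fv_tm t)"
| "fv (Neg p) = fv p"
| "fv (Conj p q) = fv p \<union> fv q"
| "fv (Exi x p) = fv p - {x}"

record ('a, 'f, 'r) struct =
  univ :: "'a set"
  fint :: "'f \<Rightarrow> 'a list \<Rightarrow> 'a"
  rint :: "'r \<Rightarrow> 'a list \<Rightarrow> bool"

definition is_struct :: "('f, 'r) lang \<Rightarrow> ('a, 'f, 'r) struct \<Rightarrow> bool" where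
  "is_struct L M \<longleftrightarrow>
     univ M \<noteq> {} \<and>
     (\<forall>f\<in>funs L. \<forall>xs. length xs = farity L f \<and> set xs \<subseteq> univ M \<longrightarrow> fint M f xs \<in> univ M)"

fun eval :: "('a, 'f, 'r) struct \<Rightarrow> (nat \<Rightarrow> 'a) \<Rightarrow> 'f tm \<Rightarrow> 'a" where
  "eval M e (Var n) = e n"
| "eval M e (Fun f ts) = fint M f (map (eval M e) ts)"

fun sat :: "('a, 'f, 'r) struct \<Rightarrow> (nat \<Rightarrow> 'a) \<Rightarrow> ('f, 'r) fm \<Rightarrow> bool" where
  "sat M e (Eq s t) \<longleftrightarrow> eval M e s = eval M e t"
| "sat M e (Rel r ts) \<longleftrightarrow> rint M r (map (eval M e) ts)"
| "sat M e (Neg p) \<longleftrightarrow> \<not> sat M e p"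
| "sat M e (Conj p q) \<longleftrightarrow> sat M e p \<and> sat M e q"
| "sat M e (Exi x p) \<longleftrightarrow> (\<exists>a\<in>univ M. sat M (e(x := a)) p)"

definition models :: "('a, 'f, 'r) struct \<Rightarrow> ('f, 'r) fm \<Rightarrow> bool" where
  "models M p \<longleftrightarrow> (\<forall>e. range e \<subseteq> univ M \<longrightarrow> sat M e p)"

definition Th :: "('f, 'r) lang \<Rightarrow> ('a, 'f, 'r) struct \<Rightarrow> ('f, 'r) fm set" where
  "Th L M = {p. wf_fm L p \<and> fv p = {} \<and> models M p}"

definition is_model :: "('f, 'r) lang \<Rightarrow> ('f, 'r) fm set \<Rightarrow> ('a, 'f, 'r) struct \<Rightarrow> bool" where
  "is_model L T M \<longleftrightarrow> is_struct L M \<and> (\<forall>p\<in>T. models M p)"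

text \<open>Elementary equivalence in \<open>L\<close>; symbols outside \<open>L\<close> are ignored.\<close>

definition elem_equiv ::
    "('f, 'r) lang \<Rightarrow> ('a, 'f, 'r) struct \<Rightarrow> ('b, 'f, 'r) struct \<Rightarrow> bool" where
  "elem_equiv L M N \<longleftrightarrow> Th L M = Th L N"

section \<open>Definable sets, definable closure, exchange\<close>

text \<open>Variable 0 is the distinguished variable; the assignment \<open>e\<close> supplies the parameters,
  substituted for the remaining free variables.\<close>

definition definable_over ::
    "('f, 'r) lang \<Rightarrow> ('a, 'f, 'r) struct \<Rightarrow> 'a set \<Rightarrow> 'a set \<Rightarrow> bool" where
  "definable_over L M A X \<longleftrightarrow>
     (\<exists>p e. wf_fm L p \<and> e ` (fv p - {0}) \<subseteq> A \<and> X = {c \<in> univ M. sat M (e(0 := c)) p})"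

definition definable :: "('f, 'r) lang \<Rightarrow> ('a, 'f, 'r) struct \<Rightarrow> 'a set \<Rightarrow> bool" where
  "definable L M X \<longleftrightarrow> definable_over L M (univ M) X"

definition dcl :: "('f, 'r) lang \<Rightarrow> ('a, 'f, 'r) struct \<Rightarrow> 'a set \<Rightarrow> 'a set" where
  "dcl L M A = {a. definable_over L M A {a}}"

definition exchange :: "('f, 'r) lang \<Rightarrow> ('a, 'f, 'r) struct \<Rightarrow> bool" where
  "exchange L M \<longleftrightarrow>
     (\<forall>A a b. A \<subseteq> univ M \<and> a \<in> univ M \<and> b \<in> univ M \<and>
        a \<in> dcl L M (A \<union> {b}) - dcl L M A \<longrightarrow> b \<in> dcl L M (A \<union> {a}))"

text \<open>All models of \<open>T\<close> whose universe is a subset of the type \<open>'u\<close> have the exchange property.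
  A failure of exchange involves only finitely many parameters, so by downward
  Loewenheim-Skolem this says the same as exchange in all models of \<open>T\<close> as soon as \<open>'u\<close> has at
  least as many elements as there are formulas.\<close>

definition satisfies_EP :: "'u itself \<Rightarrow> ('f, 'r) lang \<Rightarrow> ('f, 'r) fm set \<Rightarrow> bool" where
  "satisfies_EP _ L T \<longleftrightarrow> (\<forall>M :: ('u, 'f, 'r) struct. is_model L T M \<longrightarrow> exchange L M)"

text \<open>A type that has at least as many elements as there are formulas (if \<open>'a\<close> has at least two
  elements), and that contains a copy of \<open>'a\<close> and of its ultrapowers over sets of formulas.\<close>

type_synonym ('a, 'f, 'r) model_elem = "(('f, 'r) fm set \<Rightarrow> 'a) set"

section \<open>Presburger arithmetic and its expansions\<close>

datatype 'f pres_fun = Zero | One | Plus | Minus | ExtF 'f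

datatype 'r pres_rel = Less | Cong nat | ExtR 'r

fun pres_farity :: "'f pres_fun \<Rightarrow> nat" where
  "pres_farity Plus = 2"
| "pres_farity Minus = 1"
| "pres_farity _ = 0"

definition L_Pres :: "('f pres_fun, 'r pres_rel) lang" where
  "L_Pres = \<lparr> funs = {Zero, One, Plus, Minus}, rels = insert Less (range Cong),
              farity = pres_farity, rarity = (\<lambda>_. 2) \<rparr>"

text \<open>The values outside the symbols and arities of \<open>L_Pres\<close> are irrelevant.\<close>

fun int_fun :: "'f pres_fun \<Rightarrow> int list \<Rightarrow> int" where
  "int_fun One [] = 1"
| "int_fun Plus [x, y] = x + y"
| "int_fun Minus [x] = - x"
| "int_fun _ _ = 0"

fun int_rel :: "'r pres_rel \<Rightarrow> int list \<Rightarrow> bool" where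
  "int_rel Less [x, y] \<longleftrightarrow> x < y"
| "int_rel (Cong n) [x, y] \<longleftrightarrow> int n dvd x - y"
| "int_rel _ _ \<longleftrightarrow> False"

definition Z_struct :: "(int, 'f pres_fun, 'r pres_rel) struct" where
  "Z_struct = \<lparr> univ = UNIV, fint = int_fun, rint = int_rel \<rparr>"

type_synonym ('a, 'f, 'r) pres_struct = "('a, 'f pres_fun, 'r pres_rel) struct"

abbreviation add_in :: "('a, 'f, 'r) pres_struct \<Rightarrow> 'a \<Rightarrow> 'a \<Rightarrow> 'a" where
  "add_in G x y \<equiv> fint G Plus [x, y]"

abbreviation less_in :: "('a, 'f, 'r) pres_struct \<Rightarrow> 'a \<Rightarrow> 'a \<Rightarrow> bool" where
  "less_in G x y \<equiv> rint G Less [x, y]"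

definition le_in :: "('a, 'f, 'r) pres_struct \<Rightarrow> 'a \<Rightarrow> 'a \<Rightarrow> bool" where
  "le_in G x y \<longleftrightarrow> less_in G x y \<or> x = y"

primrec std_nat :: "('a, 'f, 'r) pres_struct \<Rightarrow> nat \<Rightarrow> 'a" where
  "std_nat G 0 = fint G Zero []"
| "std_nat G (Suc n) = add_in G (std_nat G n) (fint G One [])"

definition upper_bound :: "('a, 'f, 'r) pres_struct \<Rightarrow> 'a set \<Rightarrow> 'a \<Rightarrow> bool" where
  "upper_bound G X u \<longleftrightarrow> u \<in> univ G \<and> (\<forall>x\<in>X. le_in G x u)"

definition supremum :: "('a, 'f, 'r) pres_struct \<Rightarrow> 'a set \<Rightarrow> 'a \<Rightarrow> bool" where
  "supremum G X s \<longleftrightarrow> upper_bound G X s \<and> (\<forall>u. upper_bound G X u \<longrightarrow> le_in G s u)"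

text \<open>The supremum in \<open>G \<union> {\<infinity>}\<close> is \<open>\<infinity>\<close> iff there is no upper bound in \<open>G\<close>. The empty set has to
  be excluded: \<open>G\<close> has no least element, so the empty set has no supremum in \<open>G \<union> {\<infinity>}\<close>.\<close>

definition satisfies_DC ::
    "('f pres_fun, 'r pres_rel) lang \<Rightarrow> ('a, 'f, 'r) pres_struct \<Rightarrow> bool" where
  "satisfies_DC L G \<longleftrightarrow>
     (\<forall>X. definable L G X \<and> X \<noteq> {} \<longrightarrow>
        (\<exists>s. supremum G X s) \<or> \<not> (\<exists>u. upper_bound G X u))"

definition nat_coset :: "('a, 'f, 'r) pres_struct \<Rightarrow> nat \<Rightarrow> 'a \<Rightarrow> 'a set" where
  "nat_coset G d a = {add_in G a (std_nat G (d * n)) | n. True}"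

end

theory Submission
  imports Defs "HOL-Library.FuncSet"
begin

text \<open>Suppose that the trace \<open>S\<close> of \<open>X\<close> on the standard natural numbers is not eventually periodic,
  and for \<open>d \<ge> 1\<close> let \<open>D d = {y. (y \<in> S) \<noteq> (y + d \<in> S)}\<close>, an infinite set. If for some \<open>k\<close> all
  \<open>D d\<close> eventually had gaps of length at most \<open>k\<close>, then far out the \<open>2 ^ k + 1\<close> windows of length
  \<open>k\<close> of \<open>S\<close> starting at consecutive places would be pairwise distinct, which is impossible. Hence for
  each \<open>k\<close> some \<open>D d\<close> has infinitely many gaps longer than \<open>k\<close>. Let \<open>y\<close> be the last element of
  \<open>D d\<close> below \<open>x\<close>. For \<open>x\<close> ranging over such gaps, any finite number of formulas fails to define
  \<open>y\<close> from \<open>d\<close> and the parameters of \<open>X\<close>, and fails to define \<open>x\<close> from \<open>y\<close>, \<open>d\<close> and these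
  parameters. In an ultrapower over the finite sets of formulas this gives \<open>y\<close> in
  \<open>dcl (A \<union> {x})\<close> but not in \<open>dcl A\<close>, and \<open>x\<close> not in \<open>dcl (A \<union> {y})\<close>, against exchange.\<close>

section \<open>Semantics of formulas\<close>

lemma finite_fv_tm: "finite (fv_tm t)"
  by (induction t) auto

lemma finite_fv: "finite (fv p)"
  by (induction p) (auto simp: finite_fv_tm)

lemma eval_cong: "(\<And>n. n \<in> fv_tm t \<Longrightarrow> e n = e' n) \<Longrightarrow> eval M e t = eval M e' t"
proof (induction t)
  case (Fun f ts)
  have "eval M e t = eval M e' t" if "t \<in> set ts" for t
    by (rule Fun.IH[OF that]) (use Fun.prems that in auto)
  then have "map (eval M e) ts = map (eval M e') ts" by simp
  then show ?case by (metis eval.simps(2))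
qed simp

lemma sat_cong: "(\<And>n. n \<in> fv p \<Longrightarrow> e n = e' n) \<Longrightarrow> sat M e p \<longleftrightarrow> sat M e' p"
proof (induction p arbitrary: e e')
  case (Eq s t)
  then have "eval M e s = eval M e' s" "eval M e t = eval M e' t"
    by (auto intro!: eval_cong)
  then show ?case by simp
next
  case (Rel r ts)
  then have "map (eval M e) ts = map (eval M e') ts"
    by (auto intro!: eval_cong)
  then show ?case by (metis sat.simps(2))
next
  case (Neg p)
  have "sat M e p \<longleftrightarrow> sat M e' p" by (rule Neg.IH) (simp add: Neg.prems)
  then show ?case by simp
next
  case (Conj p q)
  have "sat M e p \<longleftrightarrow> sat M e' p" by (rule Conj.IH) (simp add: Conj.prems)
  moreover have "sat M e q \<longleftrightarrow> sat M e' q" by (rule Conj.IH) (simp add: Conj.prems)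
  ultimately show ?case by simp
next
  case (Exi x p)
  have "sat M (e(x := a)) p \<longleftrightarrow> sat M (e'(x := a)) p" for a
    by (rule Exi.IH) (simp add: Exi.prems)
  then show ?case by simp
qed

lemma eval_in_univ:
  assumes "is_struct L M" "wf_tm L t" "range e \<subseteq> univ M"
  shows "eval M e t \<in> univ M"
  using assms(2)
proof (induction t)
  case (Var n)
  then show ?case using assms(3) by auto
next
  case (Fun f ts)
  then have "set (map (eval M e) ts) \<subseteq> univ M" by auto
  then show ?case using assms(1) Fun.prems unfolding is_struct_def
    by (metis (no_types) eval.simps(2) length_map wf_tm.simps(2))
qed

definition points_defined_by :: "('a, 'f, 'r) struct \<Rightarrow> ('f, 'r) fm \<Rightarrow> 'a set \<Rightarrow> 'a set" where
  "points_defined_by M q B =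
     {a. \<exists>e. e ` (fv q - {0}) \<subseteq> B \<and> {c \<in> univ M. sat M (e(0 := c)) q} = {a}}"

lemma dcl_iff: "a \<in> dcl L M A \<longleftrightarrow> (\<exists>q. wf_fm L q \<and> a \<in> points_defined_by M q A)"
  unfolding dcl_def definable_over_def points_defined_by_def mem_Collect_eq
    eq_commute[of "{a}"]
  by simp

lemma card_points_defined_by:
  assumes "finite B"
  shows "finite (points_defined_by M q B)"
    and "card (points_defined_by M q B) \<le> card B ^ card (fv q - {0})"
proof -
  let ?V = "fv q - {0}"
  let ?h = "\<lambda>e. THE a. {c \<in> univ M. sat M (e(0 := c)) q} = {a}"
  have fin: "finite (?V \<rightarrow>\<^sub>E B)"
    by (intro finite_PiE) (auto simp: finite_fv assms)
  have sub: "points_defined_by M q B \<subseteq> ?h ` (?V \<rightarrow>\<^sub>E B)"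
  proof
    fix a assume "a \<in> points_defined_by M q B"
    then obtain e where e: "e ` ?V \<subseteq> B" "{c \<in> univ M. sat M (e(0 := c)) q} = {a}"
      unfolding points_defined_by_def by blast
    have "sat M ((restrict e ?V)(0 := c)) q \<longleftrightarrow> sat M (e(0 := c)) q" for c
      by (rule sat_cong) auto
    then have "a = ?h (restrict e ?V)" using e(2) by simp
    moreover have "restrict e ?V \<in> ?V \<rightarrow>\<^sub>E B" using e(1) by auto
    ultimately show "a \<in> ?h ` (?V \<rightarrow>\<^sub>E B)" by blast
  qed
  then show "finite (points_defined_by M q B)" using fin finite_surj by blast
  have "card (points_defined_by M q B) \<le> card (?V \<rightarrow>\<^sub>E B)"
    using sub fin by (rule surj_card_le[rotated])
  then show "card (points_defined_by M q B) \<le> card B ^ card ?V"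
    by (simp add: card_PiE finite_fv)
qed

text \<open>Quantifying over variable 0 replaces the substitution of \<open>Var v\<close> for it in \<open>q\<close>; the same device
  is used in \<open>mem_fm\<close> below.\<close>

definition unique_fm :: "nat \<Rightarrow> ('f, 'r) fm \<Rightarrow> ('f, 'r) fm" where
  "unique_fm v q = Conj (Exi 0 (Conj (Eq (Var 0) (Var v)) q))
                        (Neg (Exi 0 (Conj (Neg (Eq (Var 0) (Var v))) q)))"

lemma sat_unique_fm:
  assumes "v \<noteq> 0" "v \<notin> fv q" "a \<in> univ M"
  shows "sat M (e(v := a)) (unique_fm v q) \<longleftrightarrow> {c \<in> univ M. sat M (e(0 := c)) q} = {a}"
proof -
  have "sat M (e(v := a, 0 := c)) q \<longleftrightarrow> sat M (e(0 := c)) q" for c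
    by (rule sat_cong) (use assms in auto)
  then show ?thesis using assms by (auto simp: unique_fm_def)
qed

section \<open>Ultrapowers\<close>

definition ultra :: "'i filter \<Rightarrow> bool" where
  "ultra U \<longleftrightarrow> U \<noteq> bot \<and> (\<forall>P. eventually P U \<or> eventually (\<lambda>i. \<not> P i) U)"

lemma ultra_not: "ultra U \<Longrightarrow> eventually (\<lambda>i. \<not> P i) U \<longleftrightarrow> \<not> eventually P U"
  unfolding ultra_def using eventually_conj[of P U "\<lambda>i. \<not> P i"] by (auto simp: eventually_False)

lemma ultra_exists:
  fixes F :: "'i filter"
  assumes "F \<noteq> bot"
  shows "\<exists>U \<le> F. ultra U"
proof -
  let ?A = "{H :: 'i filter. H \<noteq> bot \<and> H \<le> F}"
  let ?P = "\<lambda>H K :: 'i filter. K \<le> H"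
  have "\<exists>U \<in> ?A. \<forall>H \<in> ?A. ?P U H \<longrightarrow> H = U"
  proof (rule predicate_Zorn)
    show "partial_order_on ?A (relation_of ?P ?A)"
      by (rule partial_order_on_relation_ofI) auto
  next
    fix C assume C: "C \<in> Chains (relation_of ?P ?A)"
    then have sub: "C \<subseteq> ?A" and tot: "\<And>H K. H \<in> C \<Longrightarrow> K \<in> C \<Longrightarrow> H \<le> K \<or> K \<le> H"
      by (auto simp: Chains_def relation_of_def)
    show "\<exists>u \<in> ?A. \<forall>H \<in> C. ?P H u"
    proof (cases "C = {}")
      case True
      then show ?thesis using assms by auto
    next
      case False
      have "eventually Q (Inf C) \<longleftrightarrow> (\<exists>H \<in> C. eventually Q H)" for Q
        by (rule eventually_Inf_base[OF False]) (metis tot inf.absorb1 inf.absorb2)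
      then have "Inf C \<noteq> bot" using sub by (auto simp: trivial_limit_def)
      moreover have "Inf C \<le> F" using False sub by (auto intro: Inf_lower2)
      ultimately show ?thesis by (auto intro: Inf_lower)
    qed
  qed
  then obtain U where U: "U \<noteq> bot" "U \<le> F"
    and max: "\<And>H. H \<noteq> bot \<Longrightarrow> H \<le> F \<Longrightarrow> H \<le> U \<Longrightarrow> H = U" by blast
  have "eventually P U \<or> eventually (\<lambda>i. \<not> P i) U" for P
  proof (cases "inf U (principal {i. P i}) = bot")
    case True
    then have "eventually (\<lambda>_. False) (inf U (principal {i. P i}))" by simp
    then show ?thesis by (simp add: eventually_inf_principal)
  next
    case False
    then have "inf U (principal {i. P i}) = U"
      using U max by (meson inf.cobounded1 order_trans)
    then have "U \<le> principal {i. P i}" by (simp add: inf.absorb_iff1)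
    then show ?thesis by (auto simp: le_principal)
  qed
  then show ?thesis using U unfolding ultra_def by blast
qed

definition ultra_class :: "'i filter \<Rightarrow> ('a, 'f, 'r) struct \<Rightarrow> ('i \<Rightarrow> 'a) \<Rightarrow> ('i \<Rightarrow> 'a) set" where
  "ultra_class U M f = {g. range g \<subseteq> univ M \<and> eventually (\<lambda>i. g i = f i) U}"

definition ultra_rep :: "('i \<Rightarrow> 'a) set \<Rightarrow> 'i \<Rightarrow> 'a" where
  "ultra_rep c = (SOME f. f \<in> c)"

definition ultrapower ::
    "'i filter \<Rightarrow> ('a, 'f, 'r) struct \<Rightarrow> (('i \<Rightarrow> 'a) set, 'f, 'r) struct" where
  "ultrapower U M =
     \<lparr> univ = {ultra_class U M f | f. range f \<subseteq> univ M},
       fint = (\<lambda>F cs. ultra_class U M (\<lambda>i. fint M F (map (\<lambda>c. ultra_rep c i) cs))),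
       rint = (\<lambda>R cs. eventually (\<lambda>i. rint M R (map (\<lambda>c. ultra_rep c i) cs)) U) \<rparr>"

lemma univ_ultrapower: "univ (ultrapower U M) = {ultra_class U M f | f. range f \<subseteq> univ M}"
  by (simp add: ultrapower_def)

lemma ultra_class_eqI:
  "eventually (\<lambda>i. f i = g i) U \<Longrightarrow> ultra_class U M f = ultra_class U M g"
  unfolding ultra_class_def by (auto elim: eventually_elim2)

lemma ultra_class_eq_iff:
  assumes "range f \<subseteq> univ M"
  shows "ultra_class U M f = ultra_class U M g \<longleftrightarrow> eventually (\<lambda>i. f i = g i) U"
proof
  assume "ultra_class U M f = ultra_class U M g"
  moreover have "f \<in> ultra_class U M f" using assms by (simp add: ultra_class_def)
  ultimately show "eventually (\<lambda>i. f i = g i) U" by (auto simp: ultra_class_def)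
qed (rule ultra_class_eqI)

lemma ultra_rep_class:
  assumes "range f \<subseteq> univ M"
  shows "eventually (\<lambda>i. ultra_rep (ultra_class U M f) i = f i) U"
proof -
  have "f \<in> ultra_class U M f" using assms by (simp add: ultra_class_def)
  then have "ultra_rep (ultra_class U M f) \<in> ultra_class U M f"
    unfolding ultra_rep_def by (rule someI[where P = "\<lambda>g. g \<in> _"])
  then show ?thesis by (simp add: ultra_class_def)
qed

lemma ultra_reps_map:
  assumes "\<And>t. t \<in> set ts \<Longrightarrow> range (g t) \<subseteq> univ M"
  shows "eventually (\<lambda>i. map (\<lambda>c. ultra_rep c i) (map (\<lambda>t. ultra_class U M (g t)) ts)
           = map (\<lambda>t. g t i) ts) U"
proof -
  have "eventually (\<lambda>i. \<forall>t \<in> set ts. ultra_rep (ultra_class U M (g t)) i = g t i) U"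
    by (rule eventually_ball_finite) (simp_all add: ultra_rep_class assms)
  then show ?thesis by eventually_elim simp
qed

lemma eval_ultrapower:
  assumes M: "is_struct L M" and f: "\<And>n. range (f n) \<subseteq> univ M"
  shows "wf_tm L t \<Longrightarrow> eval (ultrapower U M) (\<lambda>n. ultra_class U M (f n)) t
           = ultra_class U M (\<lambda>i. eval M (\<lambda>n. f n i) t)"
proof (induction t)
  case (Var n)
  then show ?case by simp
next
  case (Fun F ts)
  let ?g = "\<lambda>t i. eval M (\<lambda>n. f n i) t"
  have g: "range (?g t) \<subseteq> univ M" if "t \<in> set ts" for t
    using that Fun.prems f eval_in_univ[OF M, of t] by (fastforce simp: image_subset_iff)
  have reps: "eventually (\<lambda>i. map (\<lambda>c. ultra_rep c i) (map (\<lambda>t. ultra_class U M (?g t)) ts)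
      = map (\<lambda>t. ?g t i) ts) U"
    by (rule ultra_reps_map) (rule g)
  have "map (eval (ultrapower U M) (\<lambda>n. ultra_class U M (f n))) ts
      = map (\<lambda>t. ultra_class U M (?g t)) ts"
    using Fun by auto
  then have "eval (ultrapower U M) (\<lambda>n. ultra_class U M (f n)) (Fun F ts)
     = ultra_class U M (\<lambda>i. fint M F
         (map (\<lambda>c. ultra_rep c i) (map (\<lambda>t. ultra_class U M (?g t)) ts)))"
    by (simp only: eval.simps) (simp add: ultrapower_def)
  also have "\<dots> = ultra_class U M (\<lambda>i. fint M F (map (\<lambda>t. ?g t i) ts))"
    by (rule ultra_class_eqI, use reps in eventually_elim) (simp only:)
  finally show ?case by simp
qed

theorem sat_ultrapower:
  assumes U: "ultra U" and M: "is_struct L M"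
  shows "wf_fm L p \<Longrightarrow> (\<And>n. range (f n) \<subseteq> univ M) \<Longrightarrow>
    sat (ultrapower U M) (\<lambda>n. ultra_class U M (f n)) p
      \<longleftrightarrow> eventually (\<lambda>i. sat M (\<lambda>n. f n i) p) U"
proof (induction p arbitrary: f)
  case (Eq s t)
  have "range (\<lambda>i. eval M (\<lambda>n. f n i) s) \<subseteq> univ M"
    using Eq eval_in_univ[OF M, of s] by (fastforce simp: image_subset_iff)
  then show ?case
    using Eq eval_ultrapower[OF M, of f] by (simp add: ultra_class_eq_iff)
next
  case (Rel r ts)
  let ?g = "\<lambda>t i. eval M (\<lambda>n. f n i) t"
  have g: "range (?g t) \<subseteq> univ M" if "t \<in> set ts" for t
    using that Rel eval_in_univ[OF M, of t] by (fastforce simp: image_subset_iff)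
  have reps: "eventually (\<lambda>i. map (\<lambda>c. ultra_rep c i) (map (\<lambda>t. ultra_class U M (?g t)) ts)
      = map (\<lambda>t. ?g t i) ts) U"
    by (rule ultra_reps_map) (rule g)
  have "map (eval (ultrapower U M) (\<lambda>n. ultra_class U M (f n))) ts
      = map (\<lambda>t. ultra_class U M (?g t)) ts"
    using Rel eval_ultrapower[OF M, of f] by auto
  then have "sat (ultrapower U M) (\<lambda>n. ultra_class U M (f n)) (Rel r ts)
     \<longleftrightarrow> eventually (\<lambda>i. rint M r
         (map (\<lambda>c. ultra_rep c i) (map (\<lambda>t. ultra_class U M (?g t)) ts))) U"
    by (simp only: sat.simps) (simp add: ultrapower_def)
  also have "\<dots> \<longleftrightarrow> eventually (\<lambda>i. rint M r (map (\<lambda>t. ?g t i) ts)) U"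
    by (rule eventually_subst, use reps in eventually_elim) (simp only:)
  finally show ?case by simp
next
  case (Neg p)
  then show ?case using ultra_not[OF U] by simp
next
  case (Conj p q)
  then show ?case by (simp add: eventually_conj_iff)
next
  case (Exi x p)
  have upd: "(\<lambda>n. ultra_class U M (f n))(x := ultra_class U M g)
     = (\<lambda>n. ultra_class U M ((f(x := g)) n))" for g by (rule ext) simp
  have ev: "(\<lambda>n. (f(x := g)) n i) = (\<lambda>n. f n i)(x := g i)" for g i by (rule ext) simp
  have IH: "sat (ultrapower U M) ((\<lambda>n. ultra_class U M (f n))(x := ultra_class U M g)) p
      \<longleftrightarrow> eventually (\<lambda>i. sat M ((\<lambda>n. f n i)(x := g i)) p) U" if "range g \<subseteq> univ M" for g
    unfolding upd ev[symmetric] by (rule Exi.IH) (use Exi.prems that in auto)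
  show ?case
  proof
    assume "sat (ultrapower U M) (\<lambda>n. ultra_class U M (f n)) (Exi x p)"
    then obtain g where g: "range g \<subseteq> univ M"
      "eventually (\<lambda>i. sat M ((\<lambda>n. f n i)(x := g i)) p) U"
      using IH by (auto simp: univ_ultrapower)
    from g(2) show "eventually (\<lambda>i. sat M (\<lambda>n. f n i) (Exi x p)) U"
      by eventually_elim (use g(1) in auto)
  next
    assume ex: "eventually (\<lambda>i. sat M (\<lambda>n. f n i) (Exi x p)) U"
    obtain a0 where a0: "a0 \<in> univ M" using M by (auto simp: is_struct_def)
    define g where "g i = (if sat M (\<lambda>n. f n i) (Exi x p)
        then SOME a. a \<in> univ M \<and> sat M ((\<lambda>n. f n i)(x := a)) p else a0)" for i
    have gi: "g i \<in> univ M \<and> (sat M (\<lambda>n. f n i) (Exi x p) \<longrightarrow> sat M ((\<lambda>n. f n i)(x := g i)) p)" for i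
    proof (cases "sat M (\<lambda>n. f n i) (Exi x p)")
      case True
      then have "\<exists>a. a \<in> univ M \<and> sat M ((\<lambda>n. f n i)(x := a)) p" by auto
      from someI_ex[OF this] show ?thesis using True unfolding g_def by presburger
    next
      case False
      then show ?thesis using a0 by (simp add: g_def)
    qed
    have g: "range g \<subseteq> univ M" using gi by auto
    have "eventually (\<lambda>i. sat M ((\<lambda>n. f n i)(x := g i)) p) U"
      using ex by eventually_elim (use gi in blast)
    then have "sat (ultrapower U M) ((\<lambda>n. ultra_class U M (f n))(x := ultra_class U M g)) p"
      using IH[OF g] by simp
    then show "sat (ultrapower U M) (\<lambda>n. ultra_class U M (f n)) (Exi x p)"
      using g by (auto simp: univ_ultrapower)
  qed
qed

lemma ultrapower_assignment:
  fixes U :: "'i filter" and M :: "('a, 'f, 'r) struct" and e :: "nat \<Rightarrow> ('i \<Rightarrow> 'a) set"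
  assumes "range e \<subseteq> univ (ultrapower U M)"
  obtains f :: "nat \<Rightarrow> 'i \<Rightarrow> 'a" where "\<And>n. range (f n) \<subseteq> univ M" "e = (\<lambda>n. ultra_class U M (f n))"
proof -
  have "\<exists>g. range g \<subseteq> univ M \<and> e n = ultra_class U M g" for n
  proof -
    have "e n \<in> univ (ultrapower U M)" using assms by auto
    then show ?thesis unfolding univ_ultrapower mem_Collect_eq by metis
  qed
  then obtain f where "\<forall>n. range (f n) \<subseteq> univ M \<and> e n = ultra_class U M (f n)" by metis
  then show thesis by (intro that[of f]) auto
qed

lemma is_struct_ultrapower:
  assumes M: "is_struct L M"
  shows "is_struct L (ultrapower U M)"
  unfolding is_struct_def
proof (intro conjI ballI allI impI)
  obtain a0 where "a0 \<in> univ M" using M by (auto simp: is_struct_def)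
  then have "ultra_class U M (\<lambda>_. a0) \<in> univ (ultrapower U M)" by (auto simp: univ_ultrapower)
  then show ne: "univ (ultrapower U M) \<noteq> {}" by blast
  fix F cs
  assume F: "F \<in> funs L" and cs: "length cs = farity L F \<and> set cs \<subseteq> univ (ultrapower U M)"
  obtain c0 where c0: "c0 \<in> univ (ultrapower U M)" using ne by blast
  define e where "e n = (if n < length cs then cs ! n else c0)" for n
  have "range e \<subseteq> univ (ultrapower U M)" using cs c0 by (auto simp: e_def)
  then obtain f where f: "\<And>n. range (f n) \<subseteq> univ M" "e = (\<lambda>n. ultra_class U M (f n))"
    by (rule ultrapower_assignment) (rule that)
  let ?t = "Fun F (map Var [0..<length cs])"
  have wf: "wf_tm L ?t" using F cs by auto
  have "map e [0..<length cs] = cs" by (rule nth_equalityI) (auto simp: e_def)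
  then have "fint (ultrapower U M) F cs = eval (ultrapower U M) e ?t"
    by (simp add: comp_def)
  also have "\<dots> = ultra_class U M (\<lambda>i. eval M (\<lambda>n. f n i) ?t)"
    unfolding f(2) by (rule eval_ultrapower[OF M f(1) wf])
  also have "\<dots> \<in> univ (ultrapower U M)"
  proof -
    have "eval M (\<lambda>n. f n i) ?t \<in> univ M" for i
      by (rule eval_in_univ[OF M wf]) (use f(1) in auto)
    then show ?thesis by (auto simp: univ_ultrapower simp del: eval.simps)
  qed
  finally show "fint (ultrapower U M) F cs \<in> univ (ultrapower U M)" .
qed

lemma is_model_ultrapower:
  assumes U: "ultra U" and M: "is_struct L M"
  shows "is_model L (Th L M) (ultrapower U M)"
  unfolding is_model_def models_def
proof (intro conjI ballI allI impI)
  show "is_struct L (ultrapower U M)" using M by (rule is_struct_ultrapower)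
  fix p and e :: "nat \<Rightarrow> _" assume p: "p \<in> Th L M" and e: "range e \<subseteq> univ (ultrapower U M)"
  obtain f where f: "\<And>n. range (f n) \<subseteq> univ M" "e = (\<lambda>n. ultra_class U M (f n))"
    by (rule ultrapower_assignment[OF e]) (rule that)
  have "sat M (\<lambda>n. f n i) p" for i
    using p f(1) by (auto simp: Th_def models_def image_subset_iff)
  then show "sat (ultrapower U M) e p"
    unfolding f(2) using sat_ultrapower[OF U M] p f(1) by (simp add: Th_def)
qed

lemma singleton_ultrapower:
  assumes U: "ultra U" and M: "is_struct L M" and q: "wf_fm L q"
    and f: "\<And>n. range (f n) \<subseteq> univ M" and y: "range y \<subseteq> univ M"
  shows "{c \<in> univ (ultrapower U M).
            sat (ultrapower U M) ((\<lambda>n. ultra_class U M (f n))(0 := c)) q} = {ultra_class U M y}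
     \<longleftrightarrow> eventually (\<lambda>i. {c \<in> univ M. sat M ((\<lambda>n. f n i)(0 := c)) q} = {y i}) U"
proof -
  obtain v where v: "v \<notin> insert 0 (fv q)"
    using ex_new_if_finite[of "insert 0 (fv q)"] finite_fv infinite_UNIV_nat by blast
  have wf: "wf_fm L (unique_fm v q)" using q by (simp add: unique_fm_def)
  have Y: "ultra_class U M y \<in> univ (ultrapower U M)" using y by (auto simp: univ_ultrapower)
  have upd: "(\<lambda>n. ultra_class U M (f n))(v := ultra_class U M y)
     = (\<lambda>n. ultra_class U M ((f(v := y)) n))" by (rule ext) simp
  have ev: "(\<lambda>n. (f(v := y)) n i) = (\<lambda>n. f n i)(v := y i)" for i by (rule ext) simp
  have "{c \<in> univ (ultrapower U M).
            sat (ultrapower U M) ((\<lambda>n. ultra_class U M (f n))(0 := c)) q} = {ultra_class U M y}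
     \<longleftrightarrow> sat (ultrapower U M) ((\<lambda>n. ultra_class U M (f n))(v := ultra_class U M y)) (unique_fm v q)"
    by (rule sat_unique_fm[symmetric]) (use v Y in auto)
  also have "\<dots> \<longleftrightarrow> eventually (\<lambda>i. sat M ((\<lambda>n. f n i)(v := y i)) (unique_fm v q)) U"
    unfolding upd ev[symmetric] by (rule sat_ultrapower[OF U M wf]) (use f y in auto)
  also have "\<dots> \<longleftrightarrow> eventually (\<lambda>i. {c \<in> univ M. sat M ((\<lambda>n. f n i)(0 := c)) q} = {y i}) U"
    by (intro arg_cong[where f = "\<lambda>P. eventually P U"] ext sat_unique_fm) (use v y in auto)
  finally show ?thesis .
qed

lemma dcl_ultrapower:
  assumes U: "ultra U" and M: "is_struct L M"
    and B: "\<And>b. b \<in> B \<Longrightarrow> range b \<subseteq> univ M" and y: "range y \<subseteq> univ M"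
    and dcl: "ultra_class U M y \<in> dcl L (ultrapower U M) (ultra_class U M ` B)"
  shows "\<exists>q. wf_fm L q \<and> eventually (\<lambda>i. y i \<in> points_defined_by M q ((\<lambda>b. b i) ` B)) U"
proof -
  obtain q e where q: "wf_fm L q" and e: "e ` (fv q - {0}) \<subseteq> ultra_class U M ` B"
    and uniq: "{c \<in> univ (ultrapower U M). sat (ultrapower U M) (e(0 := c)) q} = {ultra_class U M y}"
    using dcl unfolding dcl_iff points_defined_by_def mem_Collect_eq
    by (elim exE conjE) (rule that)
  have "\<forall>n. \<exists>b. n \<in> fv q - {0} \<longrightarrow> b \<in> B \<and> e n = ultra_class U M b" using e by blast
  then obtain g where g: "\<And>n. n \<in> fv q - {0} \<Longrightarrow> g n \<in> B \<and> e n = ultra_class U M (g n)" by metis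
  define f where "f n = (if n \<in> fv q - {0} then g n else y)" for n
  have f: "range (f n) \<subseteq> univ M" for n using g B y by (auto simp: f_def)
  have "sat (ultrapower U M) ((\<lambda>n. ultra_class U M (f n))(0 := c)) q
      \<longleftrightarrow> sat (ultrapower U M) (e(0 := c)) q" for c
    by (rule sat_cong) (use g in \<open>auto simp: f_def\<close>)
  then have "eventually (\<lambda>i. {c \<in> univ M. sat M ((\<lambda>n. f n i)(0 := c)) q} = {y i}) U"
    using uniq singleton_ultrapower[OF U M q, of f y] f y by simp
  then have "eventually (\<lambda>i. y i \<in> points_defined_by M q ((\<lambda>b. b i) ` B)) U"
  proof eventually_elim
    case (elim i)
    have "(\<lambda>n. f n i) ` (fv q - {0}) \<subseteq> (\<lambda>b. b i) ` B"
      using g by (auto simp: f_def)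
    with elim show ?case unfolding points_defined_by_def by blast
  qed
  then show ?thesis using q by blast
qed

section \<open>Sets of natural numbers that are not eventually periodic\<close>

lemma not_eventually_periodic_gaps:
  fixes S :: "nat set"
  assumes np: "\<not> (\<exists>d\<ge>1. \<exists>N. \<forall>n\<ge>N. n \<in> S \<longleftrightarrow> n + d \<in> S)"
  shows "\<exists>d\<ge>1. infinite {y. (y \<in> S) \<noteq> (y + d \<in> S) \<and>
            (\<forall>j\<in>{y<..y + k}. j \<in> S \<longleftrightarrow> j + d \<in> S)}"
proof (rule ccontr)
  assume neg: "\<not> ?thesis"
  have fin: "finite {y. (y \<in> S) \<noteq> (y + d \<in> S) \<and>
            (\<forall>j\<in>{y<..y + k}. j \<in> S \<longleftrightarrow> j + d \<in> S)}" if "d \<ge> 1" for d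
    using neg that by auto
  have "\<exists>h. \<forall>x\<ge>h. \<exists>j\<in>{x<..x + k}. (j \<in> S) \<noteq> (j + d \<in> S)" if d: "d \<ge> 1" for d
  proof -
    let ?D = "{y. (y \<in> S) \<noteq> (y + d \<in> S)}"
    obtain N where "\<forall>y \<in> {y. (y \<in> S) \<noteq> (y + d \<in> S) \<and>
            (\<forall>j\<in>{y<..y + k}. j \<in> S \<longleftrightarrow> j + d \<in> S)}. y < N"
      using fin[OF d] unfolding finite_nat_set_iff_bounded by (elim exE) (rule that)
    then have N: "\<exists>j\<in>{y<..y + k}. j \<in> ?D" if "y \<ge> N" "y \<in> ?D" for y
      using that by fastforce
    obtain y0 where y0: "y0 \<ge> N" "y0 \<in> ?D" using np d by blast
    have "\<exists>j\<in>{x<..x + k}. j \<in> ?D" if x: "x \<ge> y0" for x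
    proof -
      let ?E = "{y \<in> ?D. y \<le> x}"
      have E: "finite ?E" "y0 \<in> ?E" using y0 x by auto
      define m where "m = Max ?E"
      have m: "m \<in> ?E" "\<And>z. z \<in> ?E \<Longrightarrow> z \<le> m" unfolding m_def
        using Max_in[OF E(1)] Max_ge[OF E(1)] E(2) by blast+
      have "m \<ge> N" using m(2)[OF E(2)] y0 by simp
      then obtain j where j: "j \<in> {m<..m + k}" "j \<in> ?D" using N m(1) by blast
      have "j > x"
      proof (rule ccontr)
        assume "\<not> j > x"
        then have "j \<in> ?E" using j(2) by simp
        then show False using m(2)[of j] j(1) by simp
      qed
      moreover have "m \<le> x" using m(1) by simp
      ultimately have "j \<in> {x<..x + k}" using j(1) by simp
      then show ?thesis using j(2) by (rule bexI[rotated])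
    qed
    then show ?thesis unfolding mem_Collect_eq by (intro exI[of _ y0] allI impI)
  qed
  then obtain h where h: "\<And>d x. d \<ge> 1 \<Longrightarrow> x \<ge> h d \<Longrightarrow>
      \<exists>j\<in>{x<..x + k}. (j \<in> S) \<noteq> (j + d \<in> S)" by metis
  define K where "K = (2::nat) ^ k"
  define x where "x = sum h {1..K}"
  have hx: "h d \<le> x" if "d \<in> {1..K}" for d
    unfolding x_def by (rule member_le_sum) (use that in auto)
  define w where "w i = {j \<in> {1..k}. x + i + j \<in> S}" for i
  have neq: "w i \<noteq> w i'" if "i < i'" "i' \<le> K" for i i'
  proof -
    have d: "i' - i \<in> {1..K}" using that by auto
    then obtain j where j: "j \<in> {x + i<..x + i + k}" "(j \<in> S) \<noteq> (j + (i' - i) \<in> S)"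
      using h[of "i' - i" "x + i"] hx[OF d] by fastforce
    define t where "t = j - (x + i)"
    have t: "t \<in> {1..k}" "j = x + i + t" "j + (i' - i) = x + i' + t"
      using j(1) that by (auto simp: t_def)
    have "(x + i + t \<in> S) \<noteq> (x + i' + t \<in> S)" using j(2) t(2,3) by metis
    then have "(t \<in> w i) \<noteq> (t \<in> w i')" using t(1) by (simp add: w_def)
    then show ?thesis by blast
  qed
  then have "inj_on w {0..K}"
    by (intro inj_onI) (metis atLeastAtMost_iff linorder_neqE_nat)
  moreover have "w ` {0..K} \<subseteq> Pow {1..k}" by (auto simp: w_def)
  ultimately have "card {0..K} \<le> card (Pow {1..k})" by (intro card_inj_on_le) auto
  then show False by (simp add: card_Pow K_def)
qed

section \<open>Standard natural numbers in models of Presburger arithmetic\<close>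

locale presburger_order =
  fixes G :: "('a, 'f, 'r) pres_struct"
  assumes zero_in: "fint G Zero [] \<in> univ G"
    and one_in: "fint G One [] \<in> univ G"
    and plus_in: "x \<in> univ G \<Longrightarrow> y \<in> univ G \<Longrightarrow> add_in G x y \<in> univ G"
    and plus_assoc: "x \<in> univ G \<Longrightarrow> y \<in> univ G \<Longrightarrow> z \<in> univ G \<Longrightarrow>
          add_in G (add_in G x y) z = add_in G x (add_in G y z)"
    and plus_zero: "x \<in> univ G \<Longrightarrow> add_in G x (fint G Zero []) = x"
    and less_succ: "x \<in> univ G \<Longrightarrow> y \<in> univ G \<Longrightarrow>
          less_in G x (add_in G y (fint G One [])) \<longleftrightarrow> less_in G x y \<or> x = y"
    and less_irrefl: "x \<in> univ G \<Longrightarrow> \<not> less_in G x x"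
    and succ_neg: "x \<in> univ G \<Longrightarrow> less_in G (add_in G x (fint G One [])) (fint G Zero []) \<Longrightarrow>
          less_in G x (fint G Zero [])"
begin

lemma std_in: "std_nat G n \<in> univ G"
  by (induction n) (auto simp: zero_in one_in plus_in)

lemma std_add: "add_in G (std_nat G m) (std_nat G n) = std_nat G (m + n)"
proof (induction n)
  case 0
  then show ?case by (simp add: plus_zero std_in)
next
  case (Suc n)
  then show ?case
    using plus_assoc[OF std_in std_in one_in, of m n] by simp
qed

lemma std_less: "m < n \<Longrightarrow> less_in G (std_nat G m) (std_nat G n)"
  by (induction n) (auto simp: less_succ std_in less_Suc_eq)

lemma std_inj: "std_nat G m = std_nat G n \<Longrightarrow> m = n"
  by (metis std_less less_irrefl std_in linorder_neqE_nat)

lemma std_nonneg: "\<not> less_in G (std_nat G n) (fint G Zero [])"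
  by (induction n) (auto simp: less_irrefl zero_in std_in dest: succ_neg[OF std_in])

lemma less_std:
  "z \<in> univ G \<Longrightarrow> \<not> less_in G z (fint G Zero []) \<Longrightarrow> less_in G z (std_nat G n) \<Longrightarrow>
    \<exists>j<n. z = std_nat G j"
proof (induction n)
  case (Suc n)
  then have "less_in G z (std_nat G n) \<or> z = std_nat G n"
    by (simp add: less_succ std_in)
  then show ?case using Suc.IH Suc.prems less_Suc_eq by blast
qed simp

lemma std_less_iff: "less_in G (std_nat G m) (std_nat G n) \<longleftrightarrow> m < n"
  using less_std[OF std_in std_nonneg] std_less std_inj by blast

lemma range_std_periodic:
  assumes d: "d \<ge> 1" and per: "\<And>n. n \<ge> N \<Longrightarrow> std_nat G n \<in> X \<longleftrightarrow> std_nat G (n + d) \<in> X"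
  shows "\<exists>P C. finite P \<and> finite C \<and> P \<subseteq> univ G \<and> C \<subseteq> univ G \<and>
           X \<inter> range (std_nat G) = P \<union> (\<Union>a\<in>C. nat_coset G d a)"
proof (intro exI conjI)
  let ?S = "{n. std_nat G n \<in> X}"
  let ?P = "std_nat G ` {n \<in> ?S. n < N}" and ?C = "std_nat G ` {n \<in> ?S. N \<le> n \<and> n < N + d}"
  show "finite ?P" "finite ?C" by auto
  show "?P \<subseteq> univ G" "?C \<subseteq> univ G" using std_in by auto
  have coset: "nat_coset G d (std_nat G n) = {std_nat G (n + d * m) | m. True}" for n
    by (simp add: nat_coset_def std_add)
  have mult: "n + d * m \<in> ?S \<longleftrightarrow> n \<in> ?S" if "n \<ge> N" for n m
  proof (induction m)
    case (Suc m)
    then show ?case using per[of "n + d * m"] that by (simp add: algebra_simps)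
  qed simp
  have red: "\<exists>r m. n = r + d * m \<and> N \<le> r \<and> r < N + d" if "n \<ge> N" for n
  proof (intro exI conjI)
    show "n = (N + (n - N) mod d) + d * ((n - N) div d)" using that by simp
    show "N + (n - N) mod d < N + d" using d by simp
  qed simp
  show "X \<inter> range (std_nat G) = ?P \<union> (\<Union>a\<in>?C. nat_coset G d a)"
  proof (intro equalityI subsetI)
    fix a assume "a \<in> X \<inter> range (std_nat G)"
    then obtain n where n: "a = std_nat G n" "n \<in> ?S" by auto
    show "a \<in> ?P \<union> (\<Union>a\<in>?C. nat_coset G d a)"
    proof (cases "n < N")
      case True
      then show ?thesis using n by blast
    next
      case False
      then obtain r m where r: "n = r + d * m" "N \<le> r" "r < N + d" using red[of n] by auto
      then have "r \<in> ?S" using mult[OF r(2), of m] n(2) by simp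
      then have "std_nat G r \<in> ?C" using r(2,3) by blast
      moreover have "a \<in> nat_coset G d (std_nat G r)" using n(1) r(1) by (auto simp: coset)
      ultimately show ?thesis by blast
    qed
  next
    fix a assume "a \<in> ?P \<union> (\<Union>a\<in>?C. nat_coset G d a)"
    then consider "a \<in> ?P" | n where "n \<in> ?S" "N \<le> n" "a \<in> nat_coset G d (std_nat G n)" by blast
    then show "a \<in> X \<inter> range (std_nat G)"
    proof cases
      case 2
      then obtain m where "a = std_nat G (n + d * m)" by (auto simp: coset)
      then show ?thesis using mult[OF 2(2), of m] 2(1) by auto
    qed auto
  qed
qed

end

abbreviation All :: "nat \<Rightarrow> ('f, 'r) fm \<Rightarrow> ('f, 'r) fm" where
  "All x p \<equiv> Neg (Exi x (Neg p))"

abbreviation less_fm :: "'f pres_fun tm \<Rightarrow> 'f pres_fun tm \<Rightarrow> ('f pres_fun, 'r pres_rel) fm" where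
  "less_fm s t \<equiv> Rel Less [s, t]"

abbreviation plus_tm :: "'f pres_fun tm \<Rightarrow> 'f pres_fun tm \<Rightarrow> 'f pres_fun tm" where
  "plus_tm s t \<equiv> Fun Plus [s, t]"

abbreviation zero_tm :: "'f pres_fun tm" where "zero_tm \<equiv> Fun Zero []"

abbreviation one_tm :: "'f pres_fun tm" where "one_tm \<equiv> Fun One []"

definition presburger_order_axioms_fm :: "('f pres_fun, 'r pres_rel) fm" where
  "presburger_order_axioms_fm =
     (let x = Var 0; y = Var 1; z = Var 2 in
      All 0 (All 1 (All 2
        (Conj (Eq (plus_tm (plus_tm x y) z) (plus_tm x (plus_tm y z)))
        (Conj (Eq (plus_tm x zero_tm) x)
        (Conj (Neg (Conj (less_fm x (plus_tm y one_tm)) (Conj (Neg (less_fm x y)) (Neg (Eq x y)))))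
        (Conj (Neg (Conj (less_fm x y) (Neg (less_fm x (plus_tm y one_tm)))))
        (Conj (less_fm x (plus_tm x one_tm))
        (Conj (Neg (less_fm x x))
              (Neg (Conj (less_fm (plus_tm x one_tm) zero_tm) (Neg (less_fm x zero_tm)))))))))))))"

lemma presburger_orderI:
  fixes G :: "('a, 'f pres_fun, 'r pres_rel) struct"
  assumes sub: "sublang L_Pres L" and G: "is_struct L G"
    and equiv: "elem_equiv L_Pres G (Z_struct :: (int, 'f pres_fun, 'r pres_rel) struct)"
  shows "presburger_order G"
proof -
  have closed: "fint G f xs \<in> univ G"
    if "f \<in> {Zero, One, Plus, Minus}" "length xs = pres_farity f" "set xs \<subseteq> univ G" for f xs
    using sub G that unfolding sublang_def is_struct_def L_Pres_def by auto
  have "presburger_order_axioms_fm \<in> Th L_Pres (Z_struct :: (int, 'f pres_fun, 'r pres_rel) struct)"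
    by (auto simp: Th_def presburger_order_axioms_fm_def L_Pres_def models_def Z_struct_def Let_def)
  then have "presburger_order_axioms_fm \<in> Th L_Pres G"
    using equiv unfolding elem_equiv_def by simp
  then have ax: "models G presburger_order_axioms_fm" unfolding Th_def by blast
  have fact: "add_in G (add_in G x y) z = add_in G x (add_in G y z) \<and>
      add_in G x (fint G Zero []) = x \<and>
      (less_in G x (add_in G y (fint G One [])) \<longrightarrow> less_in G x y \<or> x = y) \<and>
      (less_in G x y \<longrightarrow> less_in G x (add_in G y (fint G One []))) \<and>
      less_in G x (add_in G x (fint G One [])) \<and> \<not> less_in G x x \<and>
      (less_in G (add_in G x (fint G One [])) (fint G Zero []) \<longrightarrow> less_in G x (fint G Zero []))"
    if "x \<in> univ G" "y \<in> univ G" "z \<in> univ G" for x y z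
  proof -
    have "sat G (\<lambda>_. x) presburger_order_axioms_fm"
      using ax that(1) unfolding models_def by (simp add: image_subset_iff)
    then show ?thesis using that by (simp add: presburger_order_axioms_fm_def Let_def)
  qed
  show ?thesis
    by unfold_locales (use closed[of _ "[]"] closed[of Plus "[_, _]"] fact in \<open>simp; blast\<close>)+
qed

section \<open>The last change of a set below a point\<close>

definition changes_below :: "('a, 'f, 'r) pres_struct \<Rightarrow> 'a set \<Rightarrow> 'a \<Rightarrow> 'a \<Rightarrow> 'a set" where
  "changes_below G X d x = {z \<in> univ G. (z \<in> X) \<noteq> (add_in G z d \<in> X) \<and>
     \<not> less_in G z (fint G Zero []) \<and> less_in G z x}"

definition last_change :: "('a, 'f, 'r) pres_struct \<Rightarrow> 'a set \<Rightarrow> 'a \<Rightarrow> 'a \<Rightarrow> 'a set" where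
  "last_change G X d x =
     {c \<in> changes_below G X d x. \<not> (\<exists>z \<in> changes_below G X d x. less_in G c z)}"

lemma (in presburger_order) last_change_after_gap:
  assumes y: "(std_nat G y \<in> X) \<noteq> (std_nat G (y + d) \<in> X)"
    and gap: "\<And>j. y < j \<Longrightarrow> j < x \<Longrightarrow> std_nat G j \<in> X \<longleftrightarrow> std_nat G (j + d) \<in> X"
    and "y < x"
  shows "last_change G X (std_nat G d) (std_nat G x) = {std_nat G y}"
proof -
  have *: "changes_below G X (std_nat G d) (std_nat G x) =
      std_nat G ` {j. j < x \<and> (std_nat G j \<in> X) \<noteq> (std_nat G (j + d) \<in> X)}" (is "_ = _ ` ?J")
  proof (intro equalityI subsetI)
    fix z assume z: "z \<in> changes_below G X (std_nat G d) (std_nat G x)"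
    then obtain j where "j < x" "z = std_nat G j"
      using less_std[of z x] by (auto simp: changes_below_def)
    then show "z \<in> std_nat G ` ?J" using z by (auto simp: changes_below_def std_add)
  qed (auto simp: changes_below_def std_add std_in std_nonneg std_less)
  have J: "y \<in> ?J" "\<And>j. j \<in> ?J \<Longrightarrow> j \<le> y"
    using assms by (auto simp: not_less[symmetric])
  define J where "J = ?J"
  have "last_change G X (std_nat G d) (std_nat G x) = std_nat G ` {j \<in> J. \<forall>z\<in>J. z \<le> j}"
    unfolding last_change_def * J_def[symmetric] by (auto simp: std_less_iff not_less)
  also have "{j \<in> J. \<forall>z\<in>J. z \<le> j} = {y}"
    using J[folded J_def] by (auto intro: antisym)
  finally show ?thesis by simp
qed

text \<open>The number of points that \<open>q\<close> defines over \<open>{y, d} \<union> P\<close> is bounded independently of \<open>d\<close> and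
  \<open>y\<close>, so the length of the gap can be prescribed before \<open>d\<close> and \<open>y\<close> are chosen.\<close>

lemma (in presburger_order) last_change_avoiding_points:
  assumes np: "\<not> (\<exists>d\<ge>1. \<exists>N. \<forall>n\<ge>N. std_nat G n \<in> X \<longleftrightarrow> std_nat G (n + d) \<in> X)"
    and P: "finite P" and Q: "finite Q"
  shows "\<exists>d x y. d \<in> univ G \<and> x \<in> univ G \<and> y \<in> univ G \<and> last_change G X d x = {y} \<and>
    (\<forall>q\<in>Q. y \<notin> points_defined_by G q (insert d P) \<and>
           x \<notin> points_defined_by G q (insert y (insert d P)))"
proof -
  let ?std = "std_nat G"
  define k where "k = (\<Sum>q\<in>Q. (card P + 2) ^ card (fv q - {0}))"
  obtain d where inf: "infinite {y. (?std y \<in> X) \<noteq> (?std (y + d) \<in> X) \<and>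
      (\<forall>j\<in>{y<..y + k}. ?std j \<in> X \<longleftrightarrow> ?std (j + d) \<in> X)}" (is "infinite ?Y")
    using not_eventually_periodic_gaps[of "{n. ?std n \<in> X}" k] np by auto
  have inj: "inj_on ?std A" for A using std_inj by (auto intro: inj_onI)
  let ?bad = "\<Union>q\<in>Q. points_defined_by G q (insert (?std d) P)"
  have "finite ?bad" by (intro finite_UN_I Q card_points_defined_by(1)) (simp add: P)
  moreover have "infinite (?std ` ?Y)" using inf inj finite_imageD by blast
  ultimately have "infinite (?std ` ?Y - ?bad)" by simp
  then have "?std ` ?Y - ?bad \<noteq> {}" by (metis finite.emptyI)
  then obtain y where y: "y \<in> ?Y" "?std y \<notin> ?bad" by auto
  let ?B = "insert (?std y) (insert (?std d) P)"
  let ?badx = "\<Union>q\<in>Q. points_defined_by G q ?B"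
  have cB: "card ?B \<le> card P + 2"
    using P by (simp add: card_insert_if)
  have fin: "finite ?badx" by (intro finite_UN_I Q card_points_defined_by(1)) (simp add: P)
  have "card ?badx \<le> (\<Sum>q\<in>Q. card (points_defined_by G q ?B))" by (rule card_UN_le[OF Q])
  also have "\<dots> \<le> k" unfolding k_def
  proof (rule sum_mono)
    fix q
    have "card (points_defined_by G q ?B) \<le> card ?B ^ card (fv q - {0})"
      using P by (intro card_points_defined_by) simp
    also have "\<dots> \<le> (card P + 2) ^ card (fv q - {0})" by (rule power_mono[OF cB]) simp
    finally show "card (points_defined_by G q ?B) \<le> (card P + 2) ^ card (fv q - {0})" .
  qed
  also have "k < card (?std ` {y<..y + k + 1})" by (simp add: card_image[OF inj])
  finally have "\<not> ?std ` {y<..y + k + 1} \<subseteq> ?badx" using fin card_mono not_le by blast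
  then obtain x where x: "x \<in> {y<..y + k + 1}" "?std x \<notin> ?badx" by blast
  have "last_change G X (?std d) (?std x) = {?std y}"
    by (rule last_change_after_gap) (use x(1) y(1) in auto)
  then show ?thesis using x(2) y(2) std_in by blast
qed

definition mem_fm :: "('f, 'r) fm \<Rightarrow> 'f tm \<Rightarrow> ('f, 'r) fm" where
  "mem_fm p t = Exi 0 (Conj (Eq (Var 0) t) p)"

lemma sat_mem_fm:
  assumes "0 \<notin> fv_tm t" "eval M e t \<in> univ M"
  shows "sat M e (mem_fm p t) \<longleftrightarrow> sat M (e(0 := eval M e t)) p"
proof -
  have "eval M (e(0 := c)) t = eval M e t" for c
    by (rule eval_cong) (use assms(1) in auto)
  then show ?thesis using assms(2) by (auto simp: mem_fm_def)
qed

definition changes_below_fm ::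
    "('f pres_fun, 'r pres_rel) fm \<Rightarrow> nat \<Rightarrow> nat \<Rightarrow> nat \<Rightarrow> ('f pres_fun, 'r pres_rel) fm" where
  "changes_below_fm p d x z =
     (let p1 = mem_fm p (Var z); p2 = mem_fm p (plus_tm (Var z) (Var d)) in
      Conj (Neg (Conj (Neg (Conj p1 (Neg p2))) (Neg (Conj p2 (Neg p1)))))
        (Conj (Neg (less_fm (Var z) zero_tm)) (less_fm (Var z) (Var x))))"

lemma (in presburger_order) sat_changes_below_fm:
  assumes "d \<noteq> 0" "z \<noteq> 0" "e d \<in> univ G" "e z \<in> univ G"
    and X: "X = {c \<in> univ G. sat G (e(0 := c)) p}"
  shows "sat G e (changes_below_fm p d x z) \<longleftrightarrow> e z \<in> changes_below G X (e d) (e x)"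
proof -
  have "sat G e (mem_fm p (Var z)) \<longleftrightarrow> e z \<in> X"
    "sat G e (mem_fm p (plus_tm (Var z) (Var d))) \<longleftrightarrow> add_in G (e z) (e d) \<in> X"
    using assms plus_in[OF assms(4,3)] by (simp_all add: sat_mem_fm)
  then show ?thesis using assms(4) by (auto simp: changes_below_fm_def changes_below_def Let_def)
qed

text \<open>All variables of \<open>p\<close> lie below \<open>v\<close>; the values of \<open>x\<close> and \<open>d\<close> are those of the variables
  \<open>v + 2\<close> and \<open>v + 3\<close>.\<close>

definition last_change_fm :: "('f pres_fun, 'r pres_rel) fm \<Rightarrow> nat \<Rightarrow> ('f pres_fun, 'r pres_rel) fm" where
  "last_change_fm p v =
     Exi v (Conj (Eq (Var v) (Var 0))
       (Conj (changes_below_fm p (v + 3) (v + 2) v)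
             (Neg (Exi (v + 1) (Conj (less_fm (Var v) (Var (v + 1)))
                                     (changes_below_fm p (v + 3) (v + 2) (v + 1)))))))"

lemma fv_last_change_fm: "fv (last_change_fm p v) - {0} \<subseteq> (fv p - {0}) \<union> {v + 2, v + 3}"
  by (auto simp: last_change_fm_def changes_below_fm_def mem_fm_def Let_def)

lemma wf_last_change_fm:
  assumes "sublang L_Pres L" "wf_fm L p"
  shows "wf_fm L (last_change_fm p v)"
  using assms
  by (auto simp: last_change_fm_def changes_below_fm_def mem_fm_def Let_def sublang_def L_Pres_def)

lemma (in presburger_order) sat_last_change_fm:
  assumes v: "v > 0" "\<And>n. n \<in> fv p \<Longrightarrow> n < v"
    and e: "e (v + 2) = x" "e (v + 3) = d" and d: "d \<in> univ G" and c: "c \<in> univ G"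
    and X: "X = {c \<in> univ G. sat G (e(0 := c)) p}"
  shows "sat G (e(0 := c)) (last_change_fm p v) \<longleftrightarrow> c \<in> last_change G X d x"
proof -
  have cong: "sat G (e(0 := a, v := b, 0 := b')) p \<longleftrightarrow> sat G (e(0 := b')) p"
    "sat G (e(0 := a, v := b, v + 1 := b'', 0 := b')) p \<longleftrightarrow> sat G (e(0 := b')) p" for a b b' b''
    by (rule sat_cong, use v in force)+
  have 1: "sat G (e(0 := c, v := a)) (changes_below_fm p (v + 3) (v + 2) v) \<longleftrightarrow>
      a \<in> changes_below G X d x" if "a \<in> univ G" for a
    using sat_changes_below_fm[of "v + 3" v "e(0 := c, v := a)" X p "v + 2"] v(1) e d that X cong(1)
    by simp
  have 2: "sat G (e(0 := c, v := a, v + 1 := b)) (changes_below_fm p (v + 3) (v + 2) (v + 1)) \<longleftrightarrow>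
      b \<in> changes_below G X d x" if "b \<in> univ G" for a b
    using sat_changes_below_fm[of "v + 3" "v + 1" "e(0 := c, v := a, v + 1 := b)" X p "v + 2"]
      v(1) e d that X cong(2) by simp
  have sub: "changes_below G X d x \<subseteq> univ G" by (auto simp: changes_below_def)
  have "sat G (e(0 := c)) (last_change_fm p v) \<longleftrightarrow>
     sat G (e(0 := c, v := c)) (changes_below_fm p (v + 3) (v + 2) v) \<and>
     \<not> (\<exists>b\<in>univ G. less_in G c b \<and>
       sat G (e(0 := c, v := c, v + 1 := b)) (changes_below_fm p (v + 3) (v + 2) (v + 1)))"
    using v(1) c by (auto simp: last_change_fm_def)
  also have "\<dots> \<longleftrightarrow> c \<in> last_change G X d x"
    using 1[OF c] 2 sub by (auto simp: last_change_def)
  finally show ?thesis .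
qed

section \<open>Exchange in ultrapowers\<close>

lemma exchange_imp_eventually_periodic:
  fixes L :: "('f pres_fun, 'r pres_rel) lang"
    and G :: "('a, 'f pres_fun, 'r pres_rel) struct"
  assumes sub: "sublang L_Pres L" and G: "is_struct L G" and "presburger_order G"
    and EP: "satisfies_EP TYPE(('a, 'f pres_fun, 'r pres_rel) model_elem) L (Th L G)"
    and def: "definable L G X"
  shows "\<exists>d\<ge>1. \<exists>N. \<forall>n\<ge>N. std_nat G n \<in> X \<longleftrightarrow> std_nat G (n + d) \<in> X"
proof (rule ccontr)
  assume np: "\<not> ?thesis"
  interpret presburger_order G by fact
  obtain p e where p: "wf_fm L p" and e: "e ` (fv p - {0}) \<subseteq> univ G"
    and X: "X = {c \<in> univ G. sat G (e(0 := c)) p}"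
    using def unfolding definable_def definable_over_def by (elim exE conjE) (rule that)
  define P where "P = e ` (fv p - {0})"
  have P: "finite P" "P \<subseteq> univ G" using e by (auto simp: P_def finite_fv)
  define v where "v = Suc (Max (insert 0 (fv p)))"
  have v: "v > 0" "n < v" if "n \<in> fv p" for n
    using that by (auto simp: v_def less_Suc_eq_le finite_fv)
  obtain U :: "('f pres_fun, 'r pres_rel) fm set filter"
    where U: "U \<le> finite_subsets_at_top UNIV" "ultra U"
    using ultra_exists[OF finite_subsets_at_top_neq_bot] by blast
  have "\<exists>d x y. d \<in> univ G \<and> x \<in> univ G \<and> y \<in> univ G \<and> last_change G X d x = {y} \<and>
    (finite Q \<longrightarrow> (\<forall>q\<in>Q. y \<notin> points_defined_by G q (insert d P) \<and>
           x \<notin> points_defined_by G q (insert y (insert d P))))"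
    for Q :: "('f pres_fun, 'r pres_rel) fm set"
  proof (cases "finite Q")
    case True
    then show ?thesis using last_change_avoiding_points[OF np P(1)] by simp
  next
    case False
    then show ?thesis using last_change_avoiding_points[OF np P(1), of "{}"] by simp
  qed
  then obtain d x y where dxy: "d Q \<in> univ G" "x Q \<in> univ G" "y Q \<in> univ G"
      and last: "last_change G X (d Q) (x Q) = {y Q}"
      and avoid: "finite Q \<Longrightarrow> q \<in> Q \<Longrightarrow> y Q \<notin> points_defined_by G q (insert (d Q) P)"
        "finite Q \<Longrightarrow> q \<in> Q \<Longrightarrow> x Q \<notin> points_defined_by G q (insert (y Q) (insert (d Q) P))"
    for q and Q :: "('f pres_fun, 'r pres_rel) fm set"
    by metis
  have ran: "range d \<subseteq> univ G" "range x \<subseteq> univ G" "range y \<subseteq> univ G" using dxy by auto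
  let ?M = "ultrapower U G" and ?cl = "ultra_class U G"
  define B where "B = insert d ((\<lambda>a _. a) ` P)"
  have B: "range b \<subseteq> univ G" if "b \<in> B" for b using that ran P(2) by (auto simp: B_def)
  have Bi: "(\<lambda>b. b Q) ` B = insert (d Q) P" for Q by (auto simp: B_def image_image)
  have ev: "eventually (\<lambda>Q. finite Q \<and> q \<in> Q) U" for q
    by (rule filter_leD[OF U(1)]) (auto simp: eventually_finite_subsets_at_top intro!: exI[of _ "{q}"])
  have not_ev: False if "eventually (\<lambda>Q. \<not> (finite Q \<and> q \<in> Q)) U" for q
    using that ev[of q] ultra_not[OF U(2)] by blast
  have y_notin: "?cl y \<notin> dcl L ?M (?cl ` B)"
  proof
    assume "?cl y \<in> dcl L ?M (?cl ` B)"
    from dcl_ultrapower[OF U(2) G B ran(3) this]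
    obtain q where "eventually (\<lambda>Q. y Q \<in> points_defined_by G q (insert (d Q) P)) U"
      unfolding Bi by blast
    then have "eventually (\<lambda>Q. \<not> (finite Q \<and> q \<in> Q)) U"
      by eventually_elim (use avoid(1) in blast)
    then show False by (rule not_ev)
  qed
  have x_notin: "?cl x \<notin> dcl L ?M (?cl ` B \<union> {?cl y})"
  proof
    assume "?cl x \<in> dcl L ?M (?cl ` B \<union> {?cl y})"
    then have "?cl x \<in> dcl L ?M (?cl ` insert y B)" by simp
    from dcl_ultrapower[OF U(2) G _ ran(2) this] B ran(3)
    obtain q where "eventually (\<lambda>Q. x Q \<in> points_defined_by G q (insert (y Q) (insert (d Q) P))) U"
      unfolding image_insert Bi by blast
    then have "eventually (\<lambda>Q. \<not> (finite Q \<and> q \<in> Q)) U"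
      by eventually_elim (use avoid(2) in blast)
    then show False by (rule not_ev)
  qed
  have y_in: "?cl y \<in> dcl L ?M (?cl ` B \<union> {?cl x})"
  proof -
    define f where "f n = (if n = v + 2 then x else if n \<in> fv p - {0} then (\<lambda>_. e n) else d)" for n
    have f: "range (f n) \<subseteq> univ G" for n using ran e by (auto simp: f_def)
    have vs: "v > 0" "v + 2 \<notin> fv p" "v + 3 \<notin> fv p" using v by (force simp: v_def)+
    have "{c \<in> univ G. sat G ((\<lambda>n. f n Q)(0 := c)) (last_change_fm p v)} = {y Q}" for Q
    proof -
      have "sat G ((\<lambda>n. f n Q)(0 := c)) p \<longleftrightarrow> sat G (e(0 := c)) p" for c
        by (rule sat_cong) (use vs in \<open>auto simp: f_def\<close>)
      then have "X = {c \<in> univ G. sat G ((\<lambda>n. f n Q)(0 := c)) p}" using X by simp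
      then have "sat G ((\<lambda>n. f n Q)(0 := c)) (last_change_fm p v) \<longleftrightarrow> c \<in> last_change G X (d Q) (x Q)"
        if "c \<in> univ G" for c
        by (intro sat_last_change_fm) (use vs v dxy that in \<open>auto simp: f_def\<close>)
      then show ?thesis using dxy(3)[of Q] unfolding last[of Q] by auto
    qed
    then have "{c \<in> univ ?M. sat ?M ((\<lambda>n. ?cl (f n))(0 := c)) (last_change_fm p v)} = {?cl y}"
      using singleton_ultrapower[OF U(2) G wf_last_change_fm[OF sub p], of f y] f ran(3) by simp
    moreover have "(\<lambda>n. ?cl (f n)) ` (fv (last_change_fm p v) - {0}) \<subseteq> ?cl ` B \<union> {?cl x}"
    proof
      fix a assume "a \<in> (\<lambda>n. ?cl (f n)) ` (fv (last_change_fm p v) - {0})"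
      then obtain n where "n \<in> (fv p - {0}) \<union> {v + 2, v + 3}" "a = ?cl (f n)"
        using fv_last_change_fm[of p v] by blast
      moreover from this have "f n \<in> insert x B"
        using vs by (auto simp: f_def B_def P_def)
      ultimately show "a \<in> ?cl ` B \<union> {?cl x}" by blast
    qed
    ultimately show ?thesis
      unfolding dcl_iff points_defined_by_def using wf_last_change_fm[OF sub p] by blast
  qed
  have "exchange L ?M"
    using EP is_model_ultrapower[OF U(2) G] unfolding satisfies_EP_def by blast
  moreover have "?cl ` B \<subseteq> univ ?M" "?cl x \<in> univ ?M" "?cl y \<in> univ ?M"
    using B ran by (auto simp: univ_ultrapower)
  ultimately have "?cl x \<in> dcl L ?M (?cl ` B \<union> {?cl y})"
    using y_in y_notin unfolding exchange_def by blast
  then show False using x_notin by contradiction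
qed

theorem mainTheorem3:
  fixes L :: "('f pres_fun, 'r pres_rel) lang"
    and G :: "('a, 'f pres_fun, 'r pres_rel) struct"
    and X :: "'a set"
  assumes "sublang L_Pres L"
    and "is_struct L G"
    and "elem_equiv L_Pres G (Z_struct :: (int, 'f pres_fun, 'r pres_rel) struct)"
    and "satisfies_EP TYPE(('a, 'f pres_fun, 'r pres_rel) model_elem) L (Th L G)"
    and "satisfies_DC L G"
    and "definable L G X"
  shows "\<exists>d P C. finite P \<and> finite C \<and> P \<subseteq> univ G \<and> C \<subseteq> univ G \<and>
           X \<inter> range (std_nat G) = P \<union> (\<Union>a\<in>C. nat_coset G d a)"
proof -
  have G: "presburger_order G" using assms(1-3) by (rule presburger_orderI)
  from exchange_imp_eventually_periodic[OF assms(1,2) G assms(4,6)]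
  obtain d N where "d \<ge> 1" "\<forall>n\<ge>N. std_nat G n \<in> X \<longleftrightarrow> std_nat G (n + d) \<in> X" by blast
  then show ?thesis using presburger_order.range_std_periodic[OF G, of d N X] by blast
qed

end
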